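(* The edge Folkman number $F_e(K_3,K_3;B_3)$ does not exist; that is, for every $B_3$-free graph $G$ there is a red-blue coloring of the edges of $G$ with no monochromatic triangle.
   Context: All graphs are finite, undirected and simple. The join $G+H$ of vertex-disjoint graphs is their union together with all edges between them. The book graph $B_k$ is $K_1 + K_{1,k}$; $B_3$ consists of three triangles sharing a common edge. A graph is $H$-free if it contains no subgraph isomorphic to $H$. $F_e(K_3,K_3;H)$ is the smallest $n$ such that some $H$-free graph on $n$ vertices has the property that every red-blue edge coloring contains a monochromatic $K_3$; it "exists" if such a graph exists. *)

theory Defs
  imports Main
begin

text \<open>
  A graph is a pair of a vertex set and a set of edges, each edge being a two-element set of
  vertices.
\<close>

type_synonym 'a ugraph = "'a set \<times> 'a set set"

abbreviation verts :: "'a ugraph \<Rightarrow> 'a set" where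
  "verts G \<equiv> fst G"

abbreviation edges :: "'a ugraph \<Rightarrow> 'a set set" where
  "edges G \<equiv> snd G"

definition simple_graph :: "'a ugraph \<Rightarrow> bool" where
  "simple_graph G \<longleftrightarrow> finite (verts G) \<and> (\<forall>e\<in>edges G. e \<subseteq> verts G \<and> card e = 2)"

text \<open>Subgraphs are not required to be induced.\<close>

definition subgraph :: "'a ugraph \<Rightarrow> 'a ugraph \<Rightarrow> bool" where
  "subgraph S G \<longleftrightarrow> simple_graph S \<and> verts S \<subseteq> verts G \<and> edges S \<subseteq> edges G"

definition graph_iso :: "'a ugraph \<Rightarrow> 'b ugraph \<Rightarrow> bool" where
  "graph_iso G H \<longleftrightarrow>
     (\<exists>f. bij_betw f (verts G) (verts H) \<and> edges H = (\<lambda>e. f ` e) ` edges G)"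

definition contains_copy :: "'a ugraph \<Rightarrow> 'b ugraph \<Rightarrow> bool" where
  "contains_copy G H \<longleftrightarrow> (\<exists>S. subgraph S G \<and> graph_iso H S)"

definition graph_free :: "'b ugraph \<Rightarrow> 'a ugraph \<Rightarrow> bool" where
  "graph_free H G \<longleftrightarrow> \<not> contains_copy G H"

definition complete_graph :: "nat \<Rightarrow> nat ugraph" where
  "complete_graph n = ({..<n}, {e. e \<subseteq> {..<n} \<and> card e = 2})"

definition complete_bipartite :: "nat \<Rightarrow> nat \<Rightarrow> (nat + nat) ugraph" where
  "complete_bipartite m n =
     ({..<m} <+> {..<n}, {{Inl i, Inr j} | i j. i < m \<and> j < n})"

text \<open>The sum type makes the vertex sets of the two operands disjoint.\<close>

definition graph_join :: "'a ugraph \<Rightarrow> 'b ugraph \<Rightarrow> ('a + 'b) ugraph" where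
  "graph_join G H =
     (verts G <+> verts H,
      (\<lambda>e. Inl ` e) ` edges G \<union> (\<lambda>e. Inr ` e) ` edges H
        \<union> {{Inl u, Inr v} | u v. u \<in> verts G \<and> v \<in> verts H})"

definition book :: "nat \<Rightarrow> (nat + (nat + nat)) ugraph" where
  "book k = graph_join (complete_graph 1) (complete_bipartite 1 k)"

datatype colour = Red | Blue

text \<open>Only the values of a colouring on the edges of the graph matter.\<close>

definition colour_class :: "'a ugraph \<Rightarrow> ('a set \<Rightarrow> colour) \<Rightarrow> colour \<Rightarrow> 'a ugraph" where
  "colour_class G c x = (verts G, {e \<in> edges G. c e = x})"

definition edge_arrows :: "'a ugraph \<Rightarrow> 'b ugraph \<Rightarrow> 'c ugraph \<Rightarrow> bool" where
  "edge_arrows G H\<^sub>1 H\<^sub>2 \<longleftrightarrow>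
     (\<forall>c. contains_copy (colour_class G c Red) H\<^sub>1 \<or> contains_copy (colour_class G c Blue) H\<^sub>2)"

text \<open>
  The edge Folkman number is the least element of the following set, and it exists iff the set
  is nonempty. Graphs on natural numbers suffice, as every finite graph is isomorphic to one.
\<close>

definition edge_folkman_orders :: "'a ugraph \<Rightarrow> 'b ugraph \<Rightarrow> 'c ugraph \<Rightarrow> nat set" where
  "edge_folkman_orders H\<^sub>1 H\<^sub>2 H =
     {n. \<exists>G :: nat ugraph. simple_graph G \<and> card (verts G) = n \<and>
           graph_free H G \<and> edge_arrows G H\<^sub>1 H\<^sub>2}"

definition edge_folkman_exists :: "'a ugraph \<Rightarrow> 'b ugraph \<Rightarrow> 'c ugraph \<Rightarrow> bool" where
  "edge_folkman_exists H\<^sub>1 H\<^sub>2 H \<longleftrightarrow> edge_folkman_orders H\<^sub>1 H\<^sub>2 H \<noteq> {}"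

end

theory Submission
  imports Defs
begin

text \<open>
  In a \<open>B\<^sub>3\<close>-free graph every edge lies in at most two triangles, so it suffices to 2-colour the
  points of a finite family of sets of size at least three, each point lying in at most two of
  them, without monochromatic member. The sets are added one at a time, keeping the points
  partitioned into blocks such that every set seen so far contains two differently coloured points
  of one block, and such that each block has total spare capacity at most two, where a point has
  spare capacity two minus the number of sets through it. Every point of a new set still has
  spare capacity, so its points cannot all be in one block; two blocks meeting it are merged,
  after inverting one of them if necessary.
\<close>

section \<open>Two-colouring set families of degree at most two\<close>

definition spare :: "'e set set \<Rightarrow> 'e \<Rightarrow> nat" where
  "spare T e = 2 - card {t \<in> T. e \<in> t}"

text \<open>
  The blocks are the fibres of \<open>g\<close>. Quantifying over finite subsets of blocks avoids fixing a
  finite ground set.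
\<close>

definition block_colouring :: "'e set set \<Rightarrow> ('e \<Rightarrow> bool) \<Rightarrow> ('e \<Rightarrow> 'e) \<Rightarrow> bool" where
  "block_colouring T f g \<longleftrightarrow>
     (\<forall>t\<in>T. \<exists>p\<in>t. \<exists>q\<in>t. g p = g q \<and> f p \<noteq> f q) \<and>
     (\<forall>S l. finite S \<longrightarrow> (\<forall>x\<in>S. g x = l) \<longrightarrow> sum (spare T) S \<le> 2)"

text \<open>The degree bound on the enlarged family rules out truncation in \<open>2 - card\<close>:
  a point of \<open>t\<close> lies in at most one earlier set, so \<open>t\<close> uses up exactly
  one unit of it.\<close>

lemma spare_insert:
  assumes "finite T" "t \<notin> T" "card {s \<in> insert t T. e \<in> s} \<le> 2"
  shows "e \<in> t \<Longrightarrow> spare T e = Suc (spare (insert t T) e)"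
    and "e \<notin> t \<Longrightarrow> spare (insert t T) e = spare T e"
proof -
  assume "e \<in> t"
  then have "{s \<in> insert t T. e \<in> s} = insert t {s \<in> T. e \<in> s}" by auto
  then have "card {s \<in> insert t T. e \<in> s} = Suc (card {s \<in> T. e \<in> s})"
    using assms by simp
  then show "spare T e = Suc (spare (insert t T) e)"
    using assms(3) unfolding spare_def by linarith
next
  assume "e \<notin> t"
  then have "{s \<in> insert t T. e \<in> s} = {s \<in> T. e \<in> s}" by auto
  then show "spare (insert t T) e = spare T e" by (simp add: spare_def)
qed

text \<open>The new set costs each block that it meets at least one unit of capacity, so two such
  blocks have at most 1 + 1 = 2 left between them and may be merged.\<close>

lemma block_colouring_insert:
  assumes T: "finite T" "t \<notin> T" and t: "card t \<ge> 3"
    and deg: "\<And>e. card {s \<in> insert t T. e \<in> s} \<le> 2"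
    and fg: "block_colouring T f g"
  shows "\<exists>f' g'. block_colouring (insert t T) f' g'"
proof -
  let ?w = "spare T" and ?w' = "spare (insert t T)"
  have w_in: "?w e = Suc (?w' e)" if "e \<in> t" for e
    using spare_insert(1)[OF T deg that] .
  have w_le: "?w' e \<le> ?w e" for e
    using spare_insert[OF T deg, of e] by (cases "e \<in> t") auto
  have cap: "sum ?w S \<le> 2" if "finite S" "\<And>x. x \<in> S \<Longrightarrow> g x = l" for S l
    using conjunct2[OF fg[unfolded block_colouring_def]] that by simp
  \<comment> \<open>Otherwise three points of \<open>t\<close>, each with spare capacity at least
    one before the insertion, would lie in one block of capacity at most two.\<close>
  have "\<exists>a\<in>t. \<exists>b\<in>t. g a \<noteq> g b"
  proof (rule ccontr)
    assume *: "\<not> ?thesis"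
    obtain S where S: "S \<subseteq> t" "card S = 3" "finite S"
      using t by (meson obtain_subset_with_card_n)
    then have "S \<noteq> {}" by auto
    then obtain a where "a \<in> S" by blast
    then have "sum ?w S \<le> 2"
      using * S by (intro cap[of _ "g a"]) auto
    moreover have "(\<Sum>e\<in>S. 1) \<le> sum ?w S"
      using S w_in by (intro sum_mono) auto
    ultimately show False using S by simp
  qed
  then obtain a b where ab: "a \<in> t" "b \<in> t" "g a \<noteq> g b" by blast
  \<comment> \<open>\<open>S\<close> need not contain \<open>c\<close>, the point known to lose a
    unit, so the old bound is applied to \<open>insert c S\<close>.\<close>
  have cap': "sum ?w' S \<le> 1" if "finite S" "\<And>x. x \<in> S \<Longrightarrow> g x = g c" "c \<in> t" for S c
  proof -
    have "sum ?w' S \<le> sum ?w' (insert c S)"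
      using that by (intro sum_mono2) auto
    also have "\<dots> = ?w' c + sum ?w' (S - {c})"
      using that by (simp add: sum.insert_remove)
    also have "Suc \<dots> \<le> ?w c + sum ?w (S - {c})"
      using w_in[OF that(3)] by (simp add: sum_mono w_le)
    also have "\<dots> = sum ?w (insert c S)"
      using that by (simp add: sum.insert_remove)
    also have "\<dots> \<le> 2"
      using that by (intro cap[of _ "g c"]) auto
    finally show ?thesis by simp
  qed
  \<comment> \<open>The block of \<open>b\<close> joins that of \<open>a\<close>, and its colours
    are flipped exactly when \<open>f a = f b\<close>; hence \<open>a\<close> and \<open>b\<close>
    become the witnesses for \<open>t\<close>.\<close>
  define g' where "g' x = (if g x = g b then g a else g x)" for x
  define f' where "f' x = (if g x = g b then f x \<noteq> (f a = f b) else f x)" for x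
  have "\<exists>p\<in>s. \<exists>q\<in>s. g' p = g' q \<and> f' p \<noteq> f' q" if "s \<in> insert t T" for s
  proof (cases "s = t")
    case True
    then show ?thesis using ab by (auto simp: g'_def f'_def)
  next
    case False
    then obtain p q where "p \<in> s" "q \<in> s" "g p = g q" "f p \<noteq> f q"
      using \<open>s \<in> insert t T\<close> conjunct1[OF fg[unfolded block_colouring_def]] by blast
    \<comment> \<open>Points of one old block are flipped together or not at all, so old witnesses
      survive.\<close>
    moreover from this have "g' p = g' q" "f' p \<noteq> f' q"
      by (auto simp: g'_def f'_def)
    ultimately show ?thesis by blast
  qed
  moreover have "sum ?w' S \<le> 2" if S: "finite S" "\<forall>x\<in>S. g' x = l" for S l
  proof (cases "l = g a")
    case True
    let ?A = "{x \<in> S. g x = g a}" and ?B = "{x \<in> S. g x = g b}"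
    have "S = ?A \<union> ?B" using S True by (auto simp: g'_def split: if_splits)
    moreover have "?A \<inter> ?B = {}" using ab by auto
    ultimately have "sum ?w' S = sum ?w' ?A + sum ?w' ?B"
      using S(1) by (metis (no_types, lifting) finite_Un sum.union_disjoint)
    moreover have "sum ?w' ?A \<le> 1"
      by (rule cap'[of _ a]) (use S(1) ab in auto)
    moreover have "sum ?w' ?B \<le> 1"
      by (rule cap'[of _ b]) (use S(1) ab in auto)
    ultimately show ?thesis by linarith
  next
    case False
    \<comment> \<open>Outside the merged block \<open>S\<close> lies in an unchanged old block; for
      \<open>l = g b\<close> it is empty.\<close>
    then have "sum ?w S \<le> 2"
      using S by (intro cap[of _ l]) (auto simp: g'_def split: if_splits)
    then show ?thesis using sum_mono[of S ?w' ?w] w_le by (meson le_trans)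
  qed
  ultimately have "block_colouring (insert t T) f' g'"
    unfolding block_colouring_def by blast
  then show ?thesis by blast
qed

lemma two_colouring_of_degree_2_family:
  assumes "finite T" and "\<And>t. t \<in> T \<Longrightarrow> card t \<ge> 3"
    and "\<And>e. card {t \<in> T. e \<in> t} \<le> 2"
  shows "\<exists>f :: 'e \<Rightarrow> bool. \<forall>t\<in>T. \<exists>p\<in>t. \<exists>q\<in>t. f p \<noteq> f q"
proof -
  have "\<exists>f g. block_colouring T f g"
    using assms
  proof (induction T rule: finite_induct)
    case empty
    \<comment> \<open>The induction starts from singleton blocks, each with capacity exactly
      two.\<close>
    have cap: "sum (spare {}) S \<le> 2" if "finite S" "\<forall>x\<in>S. x = l" for S and l :: 'e
    proof -
      have "S \<subseteq> {l}" using that by auto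
      then have "sum (spare {}) S \<le> sum (spare {}) {l}" by (intro sum_mono2) auto
      then show ?thesis by (simp add: spare_def)
    qed
    have "block_colouring ({} :: 'e set set) (\<lambda>_. True) (\<lambda>x. x)"
      unfolding block_colouring_def by (intro conjI allI impI) (simp, rule cap)
    then show ?case by blast
  next
    case (insert t T)
    have "card {s \<in> T. e \<in> s} \<le> 2" for e
    proof -
      have "card {s \<in> T. e \<in> s} \<le> card {s \<in> insert t T. e \<in> s}"
        using insert.hyps by (intro card_mono) auto
      then show ?thesis using insert.prems(2) le_trans by blast
    qed
    then obtain f g where "block_colouring T f g"
      using insert.IH insert.prems(1) by auto
    then show ?case
      by (rule block_colouring_insert[OF insert.hyps insert.prems(1)[OF insertI1] insert.prems(2)])
  qed
  then obtain f g where "block_colouring T f g" by blast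
  then have "\<forall>t\<in>T. \<exists>p\<in>t. \<exists>q\<in>t. g p = g q \<and> f p \<noteq> f q"
    unfolding block_colouring_def by (rule conjunct1)
  then show ?thesis by (intro exI[of _ f]) blast
qed

section \<open>Copies of triangles and books\<close>

lemma contains_copyI:
  assumes H: "simple_graph H" and G: "simple_graph G" and f: "inj_on f (verts H)"
    and v: "f ` verts H \<subseteq> verts G" and e: "\<And>e. e \<in> edges H \<Longrightarrow> f ` e \<in> edges G"
  shows "contains_copy G H"
proof -
  let ?S = "(f ` verts H, (\<lambda>e. f ` e) ` edges H)"
  have "simple_graph ?S"
    using H G e unfolding simple_graph_def by (auto intro!: image_mono)
  then have "subgraph ?S G"
    using v e by (auto simp: subgraph_def)
  moreover have "graph_iso H ?S"
    using f unfolding graph_iso_def by (auto simp: bij_betw_def)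
  ultimately show ?thesis unfolding contains_copy_def by blast
qed

lemma contains_triangleD:
  assumes "contains_copy G (complete_graph 3)"
  obtains u v w where "u \<noteq> v" "v \<noteq> w" "u \<noteq> w"
    "{u, v} \<in> edges G" "{v, w} \<in> edges G" "{u, w} \<in> edges G"
proof -
  obtain S f where S: "edges S \<subseteq> edges G"
    and f: "bij_betw f {..<3} (verts S)"
    and E: "edges S = (\<lambda>e. f ` e) ` {e. e \<subseteq> {..<3::nat} \<and> card e = 2}"
    using assms
    by (auto simp: contains_copy_def graph_iso_def subgraph_def complete_graph_def)
  have edge: "{f i, f j} \<in> edges G" if "i < 3" "j < 3" "i \<noteq> j" for i j :: nat
  proof -
    have "f ` {i, j} \<in> edges S"
      unfolding E using that by (intro imageI) auto
    then show ?thesis using S by auto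
  qed
  have neq: "f i \<noteq> f j" if "i < 3" "j < 3" "i \<noteq> j" for i j :: nat
    using f that unfolding bij_betw_def inj_on_def by auto
  show ?thesis
    by (rule that[of "f 0" "f 1" "f 2"]; (rule edge neq)?) simp_all
qed

text \<open>\<open>Inl 0\<close> and \<open>Inr (Inl 0)\<close> are the ends of the spine, the edge
  shared by all triangles; the points \<open>Inr (Inr i)\<close> are the outer vertices of the
  pages.\<close>

lemma verts_book: "verts (book k) = {Inl 0, Inr (Inl 0)} \<union> (\<lambda>i. Inr (Inr i)) ` {..<k}"
  by (auto simp: book_def graph_join_def complete_graph_def complete_bipartite_def Plus_def)

lemma edges_book:
  "edges (book k) = {{Inl 0, Inr (Inl 0)}}
     \<union> {{Inl 0, Inr (Inr i)} | i. i < k} \<union> {{Inr (Inl 0), Inr (Inr i)} | i. i < k}"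
proof -
  have no_loop: "{e. e \<subseteq> {..<1::nat} \<and> card e = 2} = {}"
  proof -
    have "card e \<noteq> 2" if "e \<subseteq> {..<1::nat}" for e
      using card_mono[OF _ that] by simp
    then show ?thesis by blast
  qed
  have bip: "(\<lambda>e. Inr ` e) ` {{Inl i, Inr j} | i j. i < (1::nat) \<and> j < k}
      = {{Inr (Inl 0), Inr (Inr i)} | i. i < k}"
  proof -
    have "{{Inl i, Inr j} | i j. i < (1::nat) \<and> j < k} = (\<lambda>j. {Inl 0, Inr j}) ` {..<k}"
      by auto
    then show ?thesis by (auto simp: image_image)
  qed
  have cross: "{{Inl u, Inr v} | u v. u \<in> {..<1::nat} \<and> v \<in> {..<1::nat} <+> {..<k}}
      = {{Inl 0, Inr (Inl 0)}} \<union> {{Inl 0, Inr (Inr i)} | i. i < k}"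
    by (auto simp: Plus_def)
  show ?thesis
    unfolding book_def graph_join_def complete_graph_def complete_bipartite_def
      fst_conv snd_conv no_loop bip cross by blast
qed

lemma simple_graph_book: "simple_graph (book k)"
  unfolding simple_graph_def verts_book edges_book by auto

text \<open>Common neighbours of \<open>u\<close> and \<open>v\<close> serve as the outer vertices
  over the spine \<open>{u, v}\<close>. They differ from \<open>u\<close> and \<open>v\<close>
  because \<open>G\<close> has no loops.\<close>

lemma contains_bookI:
  assumes G: "simple_graph G" and uv: "{u, v} \<in> edges G"
    and W: "\<And>w. w \<in> W \<Longrightarrow> {u, w} \<in> edges G \<and> {v, w} \<in> edges G" and k: "card W = k" "finite W"
  shows "contains_copy G (book k)"
proof -
  have neq: "x \<noteq> y" if "{x, y} \<in> edges G" for x y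
    using that G unfolding simple_graph_def by fastforce
  have sub: "x \<in> verts G" "y \<in> verts G" if "{x, y} \<in> edges G" for x y
    using that G unfolding simple_graph_def by blast+
  obtain h where h: "bij_betw h {..<k} W"
    using k by (metis atLeast0LessThan ex_bij_betw_nat_finite)
  then have hW: "h i \<in> W" if "i < k" for i
    using that by (auto simp: bij_betw_def)
  define f where "f = case_sum (\<lambda>_::nat. u) (case_sum (\<lambda>_::nat. v) h)"
  have "inj_on f (verts (book k))"
  proof -
    have "u \<noteq> v" "u \<noteq> h i" "v \<noteq> h i" if "i < k" for i
      using neq[OF uv] neq W[OF hW[OF that]] by auto
    moreover have "inj_on h {..<k}"
      using h by (simp add: bij_betw_def)
    ultimately show ?thesis
      using neq[OF uv] unfolding verts_book f_def
      by (auto simp: inj_on_def)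
  qed
  moreover have "f ` verts (book k) \<subseteq> verts G"
    using sub[OF uv] sub(2)[OF conjunct1[OF W[OF hW]]] unfolding verts_book f_def by auto
  moreover have "f ` e \<in> edges G" if "e \<in> edges (book k)" for e
    using that uv W hW unfolding edges_book f_def by auto
  ultimately show ?thesis
    using contains_copyI[OF simple_graph_book G] by blast
qed

section \<open>Triangles of a book-free graph\<close>

text \<open>A triangle is encoded as its set of three edges, so that edges are the points to be
  coloured and triangles the members of the family.\<close>

definition triangles :: "'a ugraph \<Rightarrow> 'a set set set" where
  "triangles G = {{{u, v}, {v, w}, {u, w}} | u v w. u \<noteq> v \<and> v \<noteq> w \<and> u \<noteq> w \<and>
     {u, v} \<in> edges G \<and> {v, w} \<in> edges G \<and> {u, w} \<in> edges G}"

lemma finite_triangles: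
  assumes "simple_graph G"
  shows "finite (triangles G)"
proof -
  have "edges G \<subseteq> Pow (verts G)"
    using assms by (auto simp: simple_graph_def)
  then have "finite (edges G)"
    using assms finite_subset by (auto simp: simple_graph_def)
  moreover have "triangles G \<subseteq> Pow (edges G)"
    by (auto simp: triangles_def)
  ultimately show ?thesis by (meson finite_Pow_iff finite_subset)
qed

lemma card_triangle:
  assumes "t \<in> triangles G"
  shows "card t = 3"
proof -
  obtain u v w where "t = {{u, v}, {v, w}, {u, w}}" "u \<noteq> v" "v \<noteq> w" "u \<noteq> w"
    using assms by (auto simp: triangles_def)
  then show ?thesis by (simp add: doubleton_eq_iff card_insert_if)
qed

text \<open>A triangle through \<open>{u, v}\<close> is determined by its third vertex, a common
  neighbour of \<open>u\<close> and \<open>v\<close>; three common neighbours would give a book with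
  spine \<open>{u, v}\<close>.\<close>

lemma card_triangles_through_edge:
  assumes G: "simple_graph G" "graph_free (book 3) G"
  shows "card {t \<in> triangles G. e \<in> t} \<le> 2"
proof (cases "e \<in> edges G")
  case False
  then have "{t \<in> triangles G. e \<in> t} = {}"
    by (auto simp: triangles_def)
  then show ?thesis by (simp only: card.empty)
next
  case True
  then obtain u v where e: "e = {u, v}" "u \<noteq> v"
    using G by (meson card_2_iff simple_graph_def)
  let ?W = "{w. {u, w} \<in> edges G \<and> {v, w} \<in> edges G}"
  have "?W \<subseteq> verts G"
    using G(1) by (auto simp: simple_graph_def)
  then have fin: "finite ?W"
    using G(1) by (auto simp: simple_graph_def intro: finite_subset)
  have "card ?W \<le> 2"
  proof (rule ccontr)
    assume "\<not> card ?W \<le> 2"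
    then have "3 \<le> card ?W" by simp
    then obtain W where "W \<subseteq> ?W" "card W = 3" "finite W"
      by (rule obtain_subset_with_card_n)
    then have "contains_copy G (book 3)"
      using True e by (intro contains_bookI[OF G(1), of u v W]) auto
    then show False using G(2) by (simp add: graph_free_def)
  qed
  moreover have "{t \<in> triangles G. e \<in> t} \<subseteq> (\<lambda>w. {{u, v}, {u, w}, {v, w}}) ` ?W"
  proof
    fix t assume "t \<in> {t \<in> triangles G. e \<in> t}"
    then obtain x y z where t: "t = {{x, y}, {y, z}, {x, z}}" "t \<subseteq> edges G" "{u, v} \<in> t"
      by (auto simp: triangles_def e)
    \<comment> \<open>Here \<open>r\<close> is the vertex opposite to \<open>e\<close>; the three
      cases below differ only in which side of the triangle \<open>e\<close> is.\<close>
    have apex: "t \<in> (\<lambda>w. {{u, v}, {u, w}, {v, w}}) ` ?W"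
      if "{u, v} = {p, q}" "t = {{p, q}, {p, r}, {q, r}}" for p q r
    proof (rule image_eqI)
      have "u = p \<and> v = q \<or> u = q \<and> v = p"
        using that(1) by (simp add: doubleton_eq_iff)
      then show "t = {{u, v}, {u, r}, {v, r}}"
        unfolding that(2) by (elim disjE conjE) (simp_all add: insert_commute)
      then show "r \<in> ?W" using t(2) by simp
    qed
    have "{u, v} = {x, y} \<or> {u, v} = {y, z} \<or> {u, v} = {x, z}"
      using t(1,3) by simp
    then show "t \<in> (\<lambda>w. {{u, v}, {u, w}, {v, w}}) ` ?W"
    proof (elim disjE)
      assume "{u, v} = {x, y}"
      then show ?thesis by (rule apex[of _ _ z]) (simp add: t(1) insert_commute)
    next
      assume "{u, v} = {y, z}"
      then show ?thesis by (rule apex[of _ _ x]) (simp add: t(1) insert_commute)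
    next
      assume "{u, v} = {x, z}"
      then show ?thesis by (rule apex[of _ _ y]) (simp add: t(1) insert_commute)
    qed
  qed
  ultimately show ?thesis
    using fin by (meson card_image_le card_mono finite_imageI le_trans)
qed

lemma book_free_triangle_colouring:
  fixes G :: "'a ugraph"
  assumes G: "simple_graph G" "graph_free (book 3) G"
  shows "\<exists>c. \<forall>x. \<not> contains_copy (colour_class G c x) (complete_graph 3)"
proof -
  \<comment> \<open>\<open>eq_refl\<close> weakens the size three of a triangle to the lower bound
    that the colouring lemma expects.\<close>
  obtain f :: "'a set \<Rightarrow> bool" where f: "\<forall>t\<in>triangles G. \<exists>p\<in>t. \<exists>q\<in>t. f p \<noteq> f q"
    using two_colouring_of_degree_2_family[OF finite_triangles[OF G(1)]
        eq_refl[OF card_triangle[of _ G, symmetric]] card_triangles_through_edge[OF G]] by auto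
  define c where "c e = (if f e then Red else Blue)" for e
  have "\<not> contains_copy (colour_class G c x) (complete_graph 3)" for x
  proof
    assume "contains_copy (colour_class G c x) (complete_graph 3)"
    then obtain u v w where uvw: "u \<noteq> v" "v \<noteq> w" "u \<noteq> w"
      and "{u, v} \<in> edges (colour_class G c x)" "{v, w} \<in> edges (colour_class G c x)"
        "{u, w} \<in> edges (colour_class G c x)"
      by (rule contains_triangleD)
    then have E: "{u, v} \<in> edges G" "{v, w} \<in> edges G" "{u, w} \<in> edges G"
      and c: "c {u, v} = x" "c {v, w} = x" "c {u, w} = x"
      by (auto simp: colour_class_def)
    have "{{u, v}, {v, w}, {u, w}} \<in> triangles G"
      using uvw E unfolding triangles_def by blast
    then have "\<exists>p\<in>{{u, v}, {v, w}, {u, w}}. \<exists>q\<in>{{u, v}, {v, w}, {u, w}}. c p \<noteq> c q"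
      using f unfolding c_def by (metis colour.distinct(1))
    then show False using c by auto
  qed
  then show ?thesis by blast
qed

theorem theorem6:
  shows "\<not> edge_folkman_exists (complete_graph 3) (complete_graph 3) (book 3) \<and>
    (\<forall>G :: 'a ugraph. simple_graph G \<and> graph_free (book 3) G \<longrightarrow>
      (\<exists>c. \<forall>x. \<not> contains_copy (colour_class G c x) (complete_graph 3)))"
proof
  \<comment> \<open>For any candidate graph, the colouring leaves both colour classes triangle-free,
    which contradicts arrowing.\<close>
  show "\<not> edge_folkman_exists (complete_graph 3) (complete_graph 3) (book 3)"
    unfolding edge_folkman_exists_def edge_folkman_orders_def edge_arrows_def
    using book_free_triangle_colouring by fastforce
qed (simp add: book_free_triangle_colouring)

end
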